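(* Let $\gamma,\beta:[0,\infty)\to\mathbb{R}$ be continuous (not necessarily non-negative). Let $\alpha(t,g)$ be a real-valued function, continuous on $[0,\infty)\times[0,\infty)$ and locally Lipschitz with respect to $g$, that is, $|\alpha(t,g)-\alpha(t,h)|\le L(T,M)|g-h|$ whenever $t\in[0,T]$, $|g|\le M$ and $|h|\le M$, where $M>0$ is a constant and $L(T,M)>0$ is a constant independent of $g$, $h$ and $t$. Let $g(t)\ge0$ be a function defined on some interval $[0,T)$, having at every point of this interval a bounded derivative from the right $\dot g(t):=\lim_{s\to+0}\frac{g(t+s)-g(t)}{s}$, and satisfying the inequality $$\dot g(t)\le-\gamma(t)g(t)+\alpha(t,g(t))+\beta(t),\qquad g(0)=g_0,$$ at all $t\ge 0$ at which $g(t)$ is defined. Suppose there exists a function $\mu\in C^1([0,\infty))$, $\mu(t)>0$, such that $$\alpha\left(t,\frac1{\mu(t)}\right)+\beta(t)\le\frac1{\mu(t)}\left(\gamma(t)-\frac{\dot\mu(t)}{\mu(t)}\right)\quad\forall t\ge0,\qquad\text{and}\qquad\mu(0)g(0)\le1.$$ Then any such solution $g(t)\ge0$ of the inequality exists on all of $[0,\infty)$, i.e., $T=\infty$, and satisfies the estimate $$0\le g(t)\le\frac1{\mu(t)}\qquad\forall t\in[0,\infty).$$ If $\mu(0)g(0)<1$, then $0\le g(t)<\frac1{\mu(t)}$ for all $t\in[0,\infty)$.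
   Context: Here $\dot\mu=d\mu/dt$. It is not assumed a priori that the solutions $g(t)\ge0$ of the differential inequality are defined on all of $[0,\infty)$; global existence is part of the conclusion.
   Formalization: The solution g is additionally assumed continuous, and "exists on all of [0,∞)" is proved as: if g has no continuation as a solution beyond T, then T=∞, where continuations may become negative and the inequality is imposed only where they are ≥0. *)

theory Defs
  imports "HOL-Analysis.Analysis"
begin

text \<open>The interval \<open>[0, T)\<close>, with \<open>T = \<infinity>\<close> allowed; it is \<open>{0..}\<close> for \<open>T = \<infinity>\<close>.\<close>

definition time_interval :: "ereal \<Rightarrow> real set" where
  "time_interval T = {t. 0 \<le> t \<and> ereal t < T}"

text \<open>
  Lipschitz continuity of \<open>\<alpha> t\<close> on \<open>{g. 0 \<le> g \<and> \<bar>g\<bar> \<le> M}\<close>, with one constant \<open>L(\<tau>, M)\<close> for all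
  \<open>t \<in> [0, \<tau>]\<close>.  The library notion \<open>local_lipschitz\<close> is not used: it would leave the uniformity
  on \<open>[0, \<tau>] \<times> [0, M]\<close> to a compactness argument.
\<close>

definition lipschitz_second_arg :: "(real \<Rightarrow> real \<Rightarrow> real) \<Rightarrow> bool" where
  "lipschitz_second_arg \<alpha> \<longleftrightarrow>
     (\<forall>\<tau>\<ge>0. \<forall>M>0. \<exists>L>0. \<forall>t\<in>{0..\<tau>}. L-lipschitz_on {0..M} (\<alpha> t))"

text \<open>
  Solutions on \<open>[0, T)\<close> of \<open>g' \<le> - \<gamma> g + \<alpha>(t, g) + \<beta>\<close>, where \<open>g'\<close> is the (finite) derivative from
  the right.  Mathematically \<open>\<alpha>\<close> lives on \<open>[0, \<infinity>) \<times> [0, \<infinity>)\<close>, so the inequality is a condition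
  only at times \<open>t\<close> with \<open>g t \<ge> 0\<close>; for a nonnegative \<open>g\<close> that is every \<open>t \<in> [0, T)\<close>.

  Continuity has to be asked for: a finite derivative from the right does not exclude jumps
  from the left, and a function that is constant except for upward jumps satisfies
  \<open>g' \<le> 0\<close> everywhere.
\<close>

definition solves_ineq ::
    "(real \<Rightarrow> real) \<Rightarrow> (real \<Rightarrow> real \<Rightarrow> real) \<Rightarrow> (real \<Rightarrow> real) \<Rightarrow> ereal \<Rightarrow> (real \<Rightarrow> real) \<Rightarrow> bool" where
  "solves_ineq \<gamma> \<alpha> \<beta> T g \<longleftrightarrow>
     continuous_on (time_interval T) g \<and>
     (\<forall>t\<in>time_interval T. \<exists>D. (g has_real_derivative D) (at_right t) \<and>
        (0 \<le> g t \<longrightarrow> D \<le> - \<gamma> t * g t + \<alpha> t (g t) + \<beta> t))"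

text \<open>
  \<open>[0, T)\<close> is the whole interval of existence of \<open>g\<close>: no solution on a longer interval agrees
  with \<open>g\<close> on \<open>[0, T)\<close>.  A continuation may leave the domain of \<open>\<alpha>\<close> through \<open>0\<close>.
  If only nonnegative continuations were admitted, then for \<open>\<gamma> = 0\<close>, \<open>\<alpha> = 0\<close>, \<open>\<beta> = -1\<close>
  the function \<open>1/2 - t\<close> on \<open>[0, 1/2)\<close> would be maximal, although nothing blows up.
  A continuation of a nonnegative \<open>g\<close> that has a positive value at \<open>T\<close> is nonnegative on some
  \<open>[0, T'')\<close> with \<open>T'' > T\<close>, so the two kinds of continuability differ only if \<open>g\<close> tends
  to \<open>0\<close> at \<open>T\<close>.
\<close>

definition noncontinuable ::
    "(real \<Rightarrow> real) \<Rightarrow> (real \<Rightarrow> real \<Rightarrow> real) \<Rightarrow> (real \<Rightarrow> real) \<Rightarrow> ereal \<Rightarrow> (real \<Rightarrow> real) \<Rightarrow> bool" where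
  "noncontinuable \<gamma> \<alpha> \<beta> T g \<longleftrightarrow>
     \<not> (\<exists>T' h. T < T' \<and> solves_ineq \<gamma> \<alpha> \<beta> T' h \<and> (\<forall>t\<in>time_interval T. h t = g t))"

end

theory Submission
  imports Defs
begin

text \<open>
  The hypothesis on \<open>\<mu>\<close> says that \<open>w = 1/\<mu>\<close> is a supersolution: \<open>w' \<ge> - \<gamma> w + \<alpha>(t, w) + \<beta>\<close>.
  By the Lipschitz condition, \<open>u = g - w\<close> satisfies \<open>u' \<le> K \<bar>u\<bar>\<close> on every compact subinterval of
  \<open>[0, T)\<close>, which propagates both \<open>u \<le> 0\<close> and \<open>u < 0\<close>.  If \<open>T\<close> were finite, \<open>g\<close> would be bounded,
  hence \<open>g t - C t\<close> would be nonincreasing for large \<open>C\<close>, so \<open>g\<close> would have a limit at \<open>T\<close>; a straight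
  line with a sufficiently negative slope continues \<open>g\<close> as a solution of the differential inequality.
\<close>

section \<open>Comparison principles for right derivatives\<close>

text \<open>If \<open>f b\<close> were positive, there would be a last zero \<open>s < b\<close>.
  The negative right derivative makes \<open>f\<close> negative just after \<open>s\<close>, so the
  intermediate value theorem gives a later zero. Applied to the difference of a function and a
  barrier, this leaves only the points of contact to be inspected.\<close>

lemma right_derivative_neg_at_zeros_imp_nonpos:
  fixes f :: "real \<Rightarrow> real"
  assumes cont: "continuous_on {a..b} f" and "a \<le> b" and "f a \<le> 0"
    and der: "\<And>t. a \<le> t \<Longrightarrow> t < b \<Longrightarrow> f t = 0 \<Longrightarrow>
      \<exists>D<0. (f has_real_derivative D) (at_right t)"
  shows "f b \<le> 0"
proof (rule ccontr)
  assume "\<not> f b \<le> 0"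
  then have fb: "0 < f b" by simp
  define Z where "Z = {t\<in>{a..b}. f t = 0}"
  have "closed Z"
    unfolding Z_def using continuous_closed_preimage_constant[OF cont closed_real_atLeastAtMost] .
  moreover have "bounded Z"
    by (rule bounded_subset[of "{a..b}"]) (auto simp: Z_def)
  ultimately have "compact Z" by (simp add: compact_eq_bounded_closed)
  moreover have "Z \<noteq> {}"
    using IVT'[of f a 0 b] \<open>f a \<le> 0\<close> fb \<open>a \<le> b\<close> cont by (auto simp: Z_def)
  ultimately obtain s where s: "s \<in> Z" and s_max: "\<And>t. t \<in> Z \<Longrightarrow> t \<le> s"
    using compact_attains_sup[of Z] by blast
  have "s < b" using s fb by (cases "s = b") (auto simp: Z_def)
  then obtain D where "D < 0" "(f has_real_derivative D) (at_right s)"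
    using der[of s] s by (auto simp: Z_def)
  then obtain d where "d > 0" and d: "\<And>h. 0 < h \<Longrightarrow> h < d \<Longrightarrow> f (s + h) < f s"
    using has_real_derivative_neg_dec_right[of f D s "{s<..}"] by auto
  \<comment> \<open>The half keeps \<open>h\<close> strictly below \<open>d\<close>, and the second
    bound keeps \<open>s + h\<close> inside the interval.\<close>
  define h where "h = min (d / 2) (b - s)"
  have h: "0 < h" "h < d" "s + h \<le> b"
    using \<open>d > 0\<close> \<open>s < b\<close> unfolding h_def by linarith+
  have "f (s + h) \<le> 0" using d[OF h(1,2)] s by (simp add: Z_def)
  moreover have "continuous_on {s + h..b} f"
    using cont by (rule continuous_on_subset) (use s h in \<open>auto simp: Z_def\<close>)
  ultimately obtain t where "s + h \<le> t" "t \<le> b" "f t = 0"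
    using IVT'[of f "s + h" 0 b] fb h by auto
  then have "t \<in> Z" using s h by (auto simp: Z_def)
  from s_max[OF this] show False using \<open>s + h \<le> t\<close> h by simp
qed

text \<open>Subtracting \<open>c * (t - a)\<close> with \<open>c > 0\<close> makes the right
  derivative strictly negative, so the preceding criterion applies; the error
  \<open>c * (b - a)\<close> can be made arbitrarily small.\<close>

lemma right_derivative_nonpos_imp_le:
  fixes f :: "real \<Rightarrow> real"
  assumes cont: "continuous_on {a..b} f" and "a \<le> b"
    and der: "\<And>t. a \<le> t \<Longrightarrow> t < b \<Longrightarrow> \<exists>D\<le>0. (f has_real_derivative D) (at_right t)"
  shows "f b \<le> f a"
proof (rule field_le_epsilon)
  fix e :: real assume "e > 0"
  \<comment> \<open>The summand 1 keeps the denominator positive when \<open>a = b\<close>.\<close>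
  define c where "c = e / (b - a + 1)"
  have c: "c > 0" "c * (b - a) \<le> e"
    using \<open>e > 0\<close> \<open>a \<le> b\<close> by (auto simp: c_def field_simps)
  have "f b - f a - c * (b - a) \<le> 0"
  proof (rule right_derivative_neg_at_zeros_imp_nonpos[where f = "\<lambda>t. f t - f a - c * (t - a)"])
    show "continuous_on {a..b} (\<lambda>t. f t - f a - c * (t - a))"
      by (intro continuous_intros cont)
  next
    fix t assume "a \<le> t" "t < b"
    then obtain D where "D \<le> 0" and D: "(f has_real_derivative D) (at_right t)"
      using der by blast
    have "((\<lambda>t. f t - f a - c * (t - a)) has_real_derivative (D - c)) (at_right t)"
      by (auto intro!: derivative_eq_intros D)
    then show "\<exists>D<0. ((\<lambda>t. f t - f a - c * (t - a)) has_real_derivative D) (at_right t)"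
      using \<open>D \<le> 0\<close> c by (intro exI[of _ "D - c"]) auto
  qed (use \<open>a \<le> b\<close> in auto)
  then show "f b \<le> f a + e" using c by simp
qed

text \<open>The barrier is a small positive \<open>E\<close> with \<open>E' = (K + 1) * E\<close>:
  where \<open>u\<close> meets \<open>E\<close>, the slope of \<open>u\<close> is at most
  \<open>K * E < E'\<close>, so \<open>u\<close> cannot cross.\<close>

lemma right_derivative_le_abs_imp_nonpos:
  fixes u :: "real \<Rightarrow> real"
  assumes cont: "continuous_on {a..b} u" and "a \<le> b" and "u a \<le> 0" and "K \<ge> 0"
    and der: "\<And>t. a \<le> t \<Longrightarrow> t < b \<Longrightarrow> \<exists>D\<le>K * \<bar>u t\<bar>. (u has_real_derivative D) (at_right t)"
  shows "u b \<le> 0"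
proof (rule field_le_epsilon)
  fix e :: real assume "e > 0"
  \<comment> \<open>Normalised by \<open>E b = e\<close>, so that staying below the barrier gives
    \<open>u b \<le> e\<close>.\<close>
  define E where "E = (\<lambda>t. e * exp ((K + 1) * (t - b)))"
  have E_pos: "E t > 0" for t using \<open>e > 0\<close> by (simp add: E_def)
  have "u b - E b \<le> 0"
  proof (rule right_derivative_neg_at_zeros_imp_nonpos[where f = "\<lambda>t. u t - E t"])
    show "continuous_on {a..b} (\<lambda>t. u t - E t)"
      unfolding E_def by (intro continuous_intros cont)
    show "u a - E a \<le> 0" using \<open>u a \<le> 0\<close> E_pos[of a] by simp
  next
    fix t assume t: "a \<le> t" "t < b" and zero: "u t - E t = 0"
    from t obtain D where D_le: "D \<le> K * \<bar>u t\<bar>" and D: "(u has_real_derivative D) (at_right t)"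
      using der by blast
    have "((\<lambda>t. u t - E t) has_real_derivative (D - (K + 1) * E t)) (at_right t)"
      unfolding E_def by (auto intro!: derivative_eq_intros D)
    moreover have "D - (K + 1) * E t < 0"
      using D_le zero E_pos[of t] by (simp add: algebra_simps)
    ultimately show "\<exists>D<0. ((\<lambda>t. u t - E t) has_real_derivative D) (at_right t)"
      by blast
  qed (use \<open>a \<le> b\<close> in auto)
  then show "u b \<le> 0 + e" by (simp add: E_def)
qed

text \<open>Strict negativity is preserved because \<open>u\<close> stays below a negative barrier
  that starts at \<open>u a\<close> and decays to 0 too slowly to reach it. At a contact
  \<open>\<bar>u\<bar> = - E\<close>, so the slope of \<open>u\<close> is at most
  \<open>- K * E\<close>, which is less than \<open>E' = - (K + 1) * E\<close>.\<close>

lemma right_derivative_le_abs_imp_neg: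
  fixes u :: "real \<Rightarrow> real"
  assumes cont: "continuous_on {a..b} u" and "a \<le> b" and "u a < 0"
    and der: "\<And>t. a \<le> t \<Longrightarrow> t < b \<Longrightarrow> \<exists>D\<le>K * \<bar>u t\<bar>. (u has_real_derivative D) (at_right t)"
  shows "u b < 0"
proof -
  define E where "E = (\<lambda>t. u a * exp (- (K + 1) * (t - a)))"
  have E_neg: "E t < 0" for t using \<open>u a < 0\<close> by (simp add: E_def mult_neg_pos)
  have "u b - E b \<le> 0"
  proof (rule right_derivative_neg_at_zeros_imp_nonpos[where f = "\<lambda>t. u t - E t"])
    show "continuous_on {a..b} (\<lambda>t. u t - E t)"
      unfolding E_def by (intro continuous_intros cont)
    show "u a - E a \<le> 0" by (simp add: E_def)
  next
    fix t assume t: "a \<le> t" "t < b" and zero: "u t - E t = 0"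
    from t obtain D where D_le: "D \<le> K * \<bar>u t\<bar>" and D: "(u has_real_derivative D) (at_right t)"
      using der by blast
    have "((\<lambda>t. u t - E t) has_real_derivative (D + (K + 1) * E t)) (at_right t)"
      unfolding E_def by (auto intro!: derivative_eq_intros D simp: algebra_simps)
    moreover have "D + (K + 1) * E t < 0"
      using D_le zero E_neg[of t] by (simp add: algebra_simps)
    ultimately show "\<exists>D<0. ((\<lambda>t. u t - E t) has_real_derivative D) (at_right t)"
      by blast
  qed (use \<open>a \<le> b\<close> in auto)
  then show ?thesis using E_neg[of b] by linarith
qed

section \<open>Limits at the right end of the interval\<close>

text \<open>The derivative is bounded from above only, so no Lipschitz estimate is available.
  Instead \<open>g t - C * t\<close> is nonincreasing and, by the lower bound on \<open>g\<close>,
  bounded below, so it tends to its infimum.\<close>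

lemma bounded_right_derivative_imp_limit_at_left:
  fixes g :: "real \<Rightarrow> real"
  assumes cont: "continuous_on {a..<b} g" and "a < b"
    and lower: "\<And>t. a \<le> t \<Longrightarrow> t < b \<Longrightarrow> m \<le> g t"
    and der: "\<And>t. a \<le> t \<Longrightarrow> t < b \<Longrightarrow> \<exists>D\<le>C. (g has_real_derivative D) (at_right t)"
  obtains l where "(g \<longlongrightarrow> l) (at_left b)"
proof -
  define f where "f = (\<lambda>t. g t - C * t)"
  have anti: "f t \<le> f s" if st: "a \<le> s" "s \<le> t" "t < b" for s t
  proof (rule right_derivative_nonpos_imp_le[where f = f and a = s and b = t])
    have "continuous_on {s..t} g"
      using cont by (rule continuous_on_subset) (use st in auto)
    then show "continuous_on {s..t} f"
      unfolding f_def by (intro continuous_intros)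
  next
    fix r assume "s \<le> r" "r < t"
    then obtain D where "D \<le> C" and D: "(g has_real_derivative D) (at_right r)"
      using der[of r] st by auto
    have "(f has_real_derivative (D - C)) (at_right r)"
      unfolding f_def by (auto intro!: derivative_eq_intros D)
    then show "\<exists>D\<le>0. (f has_real_derivative D) (at_right r)"
      using \<open>D \<le> C\<close> by (intro exI[of _ "D - C"]) auto
  qed (use st in auto)
  have "m - \<bar>C\<bar> * (\<bar>a\<bar> + \<bar>b\<bar>) \<le> f t" if "a \<le> t" "t < b" for t
  proof -
    have "\<bar>t\<bar> \<le> \<bar>a\<bar> + \<bar>b\<bar>" using that by linarith
    then have "\<bar>C\<bar> * \<bar>t\<bar> \<le> \<bar>C\<bar> * (\<bar>a\<bar> + \<bar>b\<bar>)" by (rule mult_left_mono) simp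
    moreover have "C * t \<le> \<bar>C\<bar> * \<bar>t\<bar>" by (metis abs_ge_self abs_mult)
    ultimately show ?thesis using lower[OF that] unfolding f_def by linarith
  qed
  then have bdd: "bdd_below (f ` {a..<b})" by (intro bdd_belowI2) auto
  define l where "l = Inf (f ` {a..<b})"
  have "(f \<longlongrightarrow> l) (at_left b)"
  proof (rule decreasing_tendsto)
    show "eventually (\<lambda>t. l \<le> f t) (at_left b)"
      using eventually_at_left_real[OF \<open>a < b\<close>]
      by eventually_elim (auto simp: l_def intro!: cInf_lower bdd)
  next
    fix x assume "l < x"
    then obtain s where s: "a \<le> s" "s < b" "f s < x"
      using cInf_less_iff[OF _ bdd, of x] \<open>a < b\<close> by (auto simp: l_def)
    show "eventually (\<lambda>t. f t < x) (at_left b)"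
      using eventually_at_left_real[OF \<open>s < b\<close>]
    proof eventually_elim
      case (elim t)
      then show ?case using anti[of s t] s by auto
    qed
  qed
  then have "((\<lambda>t. f t + C * t) \<longlongrightarrow> l + C * b) (at_left b)"
    by (intro tendsto_intros)
  then show thesis using that by (simp add: f_def)
qed

section \<open>Continuation past a finite endpoint\<close>

lemma time_interval_ereal: "time_interval (ereal r) = {0..<r}"
  by (auto simp: time_interval_def)

text \<open>Since only an upper bound on the slope is imposed, no differential equation has to be
  solved: a line descending steeply from the limit of \<open>g\<close> at \<open>r\<close> is a
  continuation. Once it is below 0, the inequality imposes nothing on it.\<close>

lemma solves_ineq_continuable:
  assumes \<gamma>: "continuous_on {0..} \<gamma>" and \<beta>: "continuous_on {0..} \<beta>"
    and \<alpha>: "continuous_on ({0..} \<times> {0..}) (\<lambda>(t, x). \<alpha> t x)"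
    and "0 < r"
    and sol: "solves_ineq \<gamma> \<alpha> \<beta> (ereal r) g"
    and bounds: "\<And>t. 0 \<le> t \<Longrightarrow> t < r \<Longrightarrow> 0 \<le> g t \<and> g t \<le> W"
  shows "\<not> noncontinuable \<gamma> \<alpha> \<beta> (ereal r) g"
proof -
  define R where "R = (\<lambda>(t, x). - \<gamma> t * x + \<alpha> t x + \<beta> t)"
  have fst_cont: "continuous_on ({0..} \<times> {0..}) (\<lambda>z :: real \<times> real. k (fst z))"
    if "continuous_on {0..} k" for k :: "real \<Rightarrow> real"
    by (rule continuous_on_compose2[OF that]) (auto intro!: continuous_intros)
  have "continuous_on ({0..} \<times> {0..}) (\<lambda>z. - \<gamma> (fst z) * snd z + \<alpha> (fst z) (snd z) + \<beta> (fst z))"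
    using \<alpha> by (intro continuous_intros fst_cont \<gamma> \<beta>) (simp add: case_prod_unfold)
  then have "continuous_on ({0..} \<times> {0..}) R"
    by (simp add: R_def case_prod_unfold)
  \<comment> \<open>The box reaches one time unit beyond \<open>r\<close>, to cover the continuation
    as well.\<close>
  then have "continuous_on ({0..r + 1} \<times> {0..W}) R"
    by (rule continuous_on_subset) auto
  then have "bounded (R ` ({0..r + 1} \<times> {0..W}))"
    by (intro compact_imp_bounded compact_continuous_image compact_Times compact_Icc)
  \<comment> \<open>\<open>C\<close> has two uses: it bounds the right derivative of
    \<open>g\<close> from above, and \<open>- C\<close> is an admissible slope anywhere in the
    box.\<close>
  then obtain C where C: "\<And>t x. 0 \<le> t \<Longrightarrow> t \<le> r + 1 \<Longrightarrow> 0 \<le> x \<Longrightarrow> x \<le> W \<Longrightarrow> \<bar>R (t, x)\<bar> \<le> C"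
    by (force simp: bounded_iff)
  have g_cont: "continuous_on {0..<r} g"
    using sol by (simp add: solves_ineq_def time_interval_ereal)
  have g_der: "\<exists>D\<le>R (t, g t). (g has_real_derivative D) (at_right t)" if "0 \<le> t" "t < r" for t
    using sol bounds[OF that] that by (auto simp: solves_ineq_def time_interval_ereal R_def)
  obtain l where l: "(g \<longlongrightarrow> l) (at_left r)"
  proof (rule bounded_right_derivative_imp_limit_at_left[OF g_cont \<open>0 < r\<close>])
    show "0 \<le> g t" if "0 \<le> t" "t < r" for t using bounds[OF that] by simp
    show "\<exists>D\<le>C. (g has_real_derivative D) (at_right t)" if "0 \<le> t" "t < r" for t
      using g_der[OF that] C[of t "g t"] bounds[OF that] that by (meson abs_le_D1 less_add_one less_imp_le order_trans)
  qed
  have ev: "eventually (\<lambda>t. 0 < t \<and> t < r) (at_left r)"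
    using eventually_at_left_real[OF \<open>0 < r\<close>] by simp
  have "eventually (\<lambda>t. 0 \<le> g t) (at_left r)" "eventually (\<lambda>t. g t \<le> W) (at_left r)"
    using ev bounds by (auto elim!: eventually_mono)
  then have "0 \<le> l" "l \<le> W"
    using tendsto_lowerbound[OF l] tendsto_upperbound[OF l] by auto
  define h where "h = (\<lambda>t. if t < r then g t else l - C * (t - r))"
  \<comment> \<open>The line must not rise above \<open>W\<close>, or it would leave the box on
    which \<open>C\<close> is a bound.\<close>
  have C_nonneg: "0 \<le> C" using C[of r l] \<open>0 < r\<close> \<open>0 \<le> l\<close> \<open>l \<le> W\<close> by force
  have h_cont_left: "continuous_on {0..r} h"
  proof (rule continuous_on_IccI)
    have "continuous_on {0..r / 2} g"
      using g_cont by (rule continuous_on_subset) (use \<open>0 < r\<close> in auto)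
    then have "(g \<longlongrightarrow> g 0) (at_right 0)"
      by (rule continuous_on_Icc_at_rightD) (use \<open>0 < r\<close> in simp)
    moreover have "eventually (\<lambda>t. h t = g t) (at_right 0)"
      using eventually_at_right_real[OF \<open>0 < r\<close>] by eventually_elim (simp add: h_def)
    ultimately show "(h \<longlongrightarrow> h 0) (at_right 0)"
      using \<open>0 < r\<close> by (subst tendsto_cong) (auto simp: h_def)
    have "eventually (\<lambda>t. h t = g t) (at_left r)"
      using ev by eventually_elim (simp add: h_def)
    then show "(h \<longlongrightarrow> h r) (at_left r)"
      using l by (subst tendsto_cong) (auto simp: h_def)
    show "h \<midarrow>t\<rightarrow> h t" if "0 < t" "t < r" for t
    proof -
      have "continuous_on {0<..<r} g" using g_cont by (rule continuous_on_subset) auto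
      then have "continuous_on {0<..<r} h"
        by (rule continuous_on_eq) (auto simp: h_def)
      then show ?thesis
        using that continuous_on_eq_continuous_at[of "{0<..<r}" h] by (auto simp: isCont_def)
    qed
  qed (use \<open>0 < r\<close> in auto)
  have "continuous_on {r..r + 1} (\<lambda>t. l - C * (t - r))" by (intro continuous_intros)
  then have h_cont_right: "continuous_on {r..r + 1} h"
    by (rule continuous_on_eq) (auto simp: h_def)
  have "continuous_on ({0..r} \<union> {r..r + 1}) h"
    by (intro continuous_on_closed_Un h_cont_left h_cont_right) auto
  then have h_cont: "continuous_on {0..<r + 1} h"
    by (rule continuous_on_subset) auto
  have h_der: "\<exists>D. (h has_real_derivative D) (at_right t) \<and> (0 \<le> h t \<longrightarrow> D \<le> R (t, h t))"
    if t: "0 \<le> t" "t < r + 1" for t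
  proof (cases "t < r")
    case True
    obtain D where "D \<le> R (t, g t)" and D: "(g has_real_derivative D) (at_right t)"
      using g_der t(1) True by blast
    \<comment> \<open>A right derivative depends only on the values at \<open>t\<close> and just
      after it, and there \<open>h\<close> still agrees with \<open>g\<close>.\<close>
    have "eventually (\<lambda>s. g s = h s) (at_right t)"
      using eventually_at_right_real[OF True] by eventually_elim (simp add: h_def)
    then have "(h has_real_derivative D) (at_right t)"
      using D has_field_derivative_cong_eventually[of g h t "{t<..}" D] True by (simp add: h_def)
    then show ?thesis using \<open>D \<le> R (t, g t)\<close> True by (auto simp: h_def)
  next
    \<comment> \<open>This includes the junction \<open>t = r\<close>, where the right derivative
      sees only the line.\<close>
    case False
    have "((\<lambda>s. l - C * (s - r)) has_real_derivative - C) (at_right t)"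
      by (auto intro!: derivative_eq_intros)
    moreover have "eventually (\<lambda>s. l - C * (s - r) = h s) (at_right t)"
      unfolding eventually_at_filter using False by (auto simp: h_def)
    ultimately have "(h has_real_derivative - C) (at_right t)"
      using has_field_derivative_cong_eventually[of "\<lambda>s. l - C * (s - r)" h t "{t<..}"] False
      by (simp add: h_def)
    moreover have "0 \<le> C * (t - r)" using False C_nonneg by simp
    then have "h t \<le> W" using False \<open>l \<le> W\<close> unfolding h_def by simp
    then have "- C \<le> R (t, h t)" if "0 \<le> h t"
      using C[of t "h t"] t that by linarith
    ultimately show ?thesis by blast
  qed
  have "solves_ineq \<gamma> \<alpha> \<beta> (ereal (r + 1)) h"
    unfolding solves_ineq_def time_interval_ereal
    using h_cont h_der by (auto simp: R_def)
  moreover have "\<forall>t\<in>time_interval (ereal r). h t = g t"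
    by (simp add: time_interval_ereal h_def)
  moreover have "ereal r < ereal (r + 1)" by simp
  ultimately show ?thesis unfolding noncontinuable_def by blast
qed

section \<open>Comparison with a supersolution\<close>

text \<open>Subtracting the two inequalities cancels \<open>\<beta>\<close>. The term with
  \<open>\<gamma>\<close> is controlled by a bound \<open>G\<close> of
  \<open>\<bar>\<gamma>\<bar>\<close> on \<open>[0, b]\<close>, and the difference of the
  \<open>\<alpha>\<close> terms by a Lipschitz constant \<open>L\<close>; \<open>K = G + L\<close>
  may depend on \<open>b\<close>.\<close>

lemma solves_ineq_difference_right_derivative:
  assumes \<gamma>: "continuous_on {0..} \<gamma>" and lip: "lipschitz_second_arg \<alpha>"
    and sol: "solves_ineq \<gamma> \<alpha> \<beta> T g"
    and nonneg: "\<forall>t\<in>time_interval T. 0 \<le> g t"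
    and w_der: "\<And>t. 0 \<le> t \<Longrightarrow> (w has_real_derivative w' t) (at t within {0..})"
    and w_nonneg: "\<And>t. 0 \<le> t \<Longrightarrow> 0 \<le> w t"
    and super: "\<And>t. 0 \<le> t \<Longrightarrow> - \<gamma> t * w t + \<alpha> t (w t) + \<beta> t \<le> w' t"
    and b: "b \<in> time_interval T"
  obtains K where "K \<ge> 0" "continuous_on {0..b} (\<lambda>t. g t - w t)"
    "\<And>t. 0 \<le> t \<Longrightarrow> t < b \<Longrightarrow>
      \<exists>D\<le>K * \<bar>g t - w t\<bar>. ((\<lambda>t. g t - w t) has_real_derivative D) (at_right t)"
proof -
  have "0 \<le> b" using b by (simp add: time_interval_def)
  have sub: "{0..b} \<subseteq> time_interval T"
    using b by (auto simp: time_interval_def intro: le_less_trans[of _ "ereal b"])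
  have g_cont: "continuous_on {0..b} g"
    using sol sub by (auto simp: solves_ineq_def intro: continuous_on_subset)
  have "continuous_on {0..} w"
    using w_der by (intro DERIV_continuous_on) auto
  then have w_cont: "continuous_on {0..b} w"
    by (rule continuous_on_subset) auto
  have bound: "\<exists>B. \<forall>t\<in>{0..b}. \<bar>k t\<bar> \<le> B" if "continuous_on {0..b} k" for k :: "real \<Rightarrow> real"
    using compact_imp_bounded[OF compact_continuous_image[OF that compact_Icc]]
    by (auto simp: bounded_iff)
  obtain M\<^sub>g where M\<^sub>g: "\<And>t. t \<in> {0..b} \<Longrightarrow> \<bar>g t\<bar> \<le> M\<^sub>g" using bound[OF g_cont] by blast
  obtain M\<^sub>w where M\<^sub>w: "\<And>t. t \<in> {0..b} \<Longrightarrow> \<bar>w t\<bar> \<le> M\<^sub>w" using bound[OF w_cont] by blast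
  have "continuous_on {0..b} \<gamma>" using \<gamma> by (rule continuous_on_subset) auto
  then obtain G where G: "\<And>t. t \<in> {0..b} \<Longrightarrow> \<bar>\<gamma> t\<bar> \<le> G" using bound by blast
  \<comment> \<open>Large enough for both ranges on \<open>[0, b]\<close>; the 1 makes
    \<open>M\<close> positive, as the Lipschitz condition demands.\<close>
  define M where "M = max 1 (max M\<^sub>g M\<^sub>w)"
  have "M > 0" by (simp add: M_def)
  then obtain L where "L > 0" and L: "\<And>t. t \<in> {0..b} \<Longrightarrow> L-lipschitz_on {0..M} (\<alpha> t)"
    using lip \<open>0 \<le> b\<close> unfolding lipschitz_second_arg_def by blast
  have "G \<ge> 0" using G[of 0] \<open>0 \<le> b\<close> by force
  show thesis
  proof (rule that[of "G + L"])
    show "G + L \<ge> 0" using \<open>G \<ge> 0\<close> \<open>L > 0\<close> by simp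
    show "continuous_on {0..b} (\<lambda>t. g t - w t)" by (intro continuous_intros g_cont w_cont)
  next
    fix t assume "0 \<le> t" "t < b"
    then have t: "t \<in> {0..b}" by simp
    then have "t \<in> time_interval T" using sub by blast
    then obtain D where D: "(g has_real_derivative D) (at_right t)"
        and D_le: "D \<le> - \<gamma> t * g t + \<alpha> t (g t) + \<beta> t" and "0 \<le> g t"
      using sol nonneg unfolding solves_ineq_def by blast
    \<comment> \<open>The derivative within \<open>[0, \<infinity>)\<close> restricts to the
      right-hand one because \<open>{t<..}\<close> lies in \<open>{0..}\<close>.\<close>
    have "(w has_real_derivative w' t) (at_right t)"
      using w_der[OF \<open>0 \<le> t\<close>] by (rule has_field_derivative_subset) (use \<open>0 \<le> t\<close> in auto)
    with D have der: "((\<lambda>t. g t - w t) has_real_derivative (D - w' t)) (at_right t)"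
      by (rule DERIV_diff)
    have "g t \<in> {0..M}" "w t \<in> {0..M}"
      using M\<^sub>g[OF t] M\<^sub>w[OF t] \<open>0 \<le> g t\<close> w_nonneg[OF \<open>0 \<le> t\<close>] by (auto simp: M_def)
    then have "\<bar>\<alpha> t (g t) - \<alpha> t (w t)\<bar> \<le> L * \<bar>g t - w t\<bar>"
      using lipschitz_onD[OF L[OF t]] by (simp add: dist_real_def)
    moreover have "- \<gamma> t * (g t - w t) \<le> G * \<bar>g t - w t\<bar>"
    proof -
      have "- \<gamma> t * (g t - w t) \<le> \<bar>\<gamma> t\<bar> * \<bar>g t - w t\<bar>"
        by (metis abs_ge_self abs_minus_cancel abs_mult)
      also have "\<dots> \<le> G * \<bar>g t - w t\<bar>" by (rule mult_right_mono[OF G[OF t]]) simp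
      finally show ?thesis .
    qed
    ultimately have "D - w' t \<le> (G + L) * \<bar>g t - w t\<bar>"
      using D_le super[OF \<open>0 \<le> t\<close>] by (simp add: algebra_simps)
    with der show "\<exists>D\<le>(G + L) * \<bar>g t - w t\<bar>.
        ((\<lambda>t. g t - w t) has_real_derivative D) (at_right t)" by blast
  qed
qed

section \<open>The bound by \<open>1 / \<mu>\<close> and global existence\<close>

text \<open>Only \<open>T = \<infinity>\<close> is tied to maximality: a solution restricted to a
  shorter interval is again a solution, so finite \<open>T\<close> can be excluded only for
  noncontinuable \<open>g\<close>. The estimates hold on every interval of definition.\<close>

theorem theorem1:
  fixes \<gamma> \<beta> g \<mu> \<mu>' :: "real \<Rightarrow> real"
    and \<alpha> :: "real \<Rightarrow> real \<Rightarrow> real"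
    and T :: ereal
  assumes "continuous_on {0..} \<gamma>"
    and "continuous_on {0..} \<beta>"
    and "continuous_on ({0..} \<times> {0..}) (\<lambda>(t, x). \<alpha> t x)"
    and "lipschitz_second_arg \<alpha>"
    and "0 < T"
    and "\<forall>t\<in>time_interval T. 0 \<le> g t"
    and "solves_ineq \<gamma> \<alpha> \<beta> T g"
    and "\<forall>t\<ge>0. (\<mu> has_real_derivative \<mu>' t) (at t within {0..})"
    and "continuous_on {0..} \<mu>'"
    and "\<forall>t\<ge>0. 0 < \<mu> t"
    and "\<forall>t\<ge>0. \<alpha> t (1 / \<mu> t) + \<beta> t \<le> 1 / \<mu> t * (\<gamma> t - \<mu>' t / \<mu> t)"
    and "\<mu> 0 * g 0 \<le> 1"
  shows "(noncontinuable \<gamma> \<alpha> \<beta> T g \<longrightarrow> T = \<infinity>) \<and>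
         (\<forall>t\<in>time_interval T. 0 \<le> g t \<and> g t \<le> 1 / \<mu> t) \<and>
         (\<mu> 0 * g 0 < 1 \<longrightarrow> (\<forall>t\<in>time_interval T. 0 \<le> g t \<and> g t < 1 / \<mu> t))"
proof -
  define w where "w = (\<lambda>t. 1 / \<mu> t)"
  define w' where "w' = (\<lambda>t. - \<mu>' t / (\<mu> t)\<^sup>2)"
  have \<mu>_pos: "0 < \<mu> t" if "0 \<le> t" for t using assms(10) that by blast
  have w_der: "(w has_real_derivative w' t) (at t within {0..})" if "0 \<le> t" for t
  proof -
    have "(\<mu> has_real_derivative \<mu>' t) (at t within {0..})" using assms(8) that by blast
    then show ?thesis
      unfolding w_def w'_def using \<mu>_pos[OF that]
      by (auto intro!: derivative_eq_intros simp: power2_eq_square)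
  qed
  have w_nonneg: "0 \<le> w t" if "0 \<le> t" for t using \<mu>_pos[OF that] by (simp add: w_def)
  have super: "- \<gamma> t * w t + \<alpha> t (w t) + \<beta> t \<le> w' t" if "0 \<le> t" for t
  proof -
    have "\<alpha> t (w t) + \<beta> t \<le> 1 / \<mu> t * (\<gamma> t - \<mu>' t / \<mu> t)"
      using assms(11) that by (simp add: w_def)
    also have "\<dots> = \<gamma> t * w t + w' t"
      using \<mu>_pos[OF that] by (simp add: w_def w'_def field_simps power2_eq_square)
    finally show ?thesis by simp
  qed
  note difference = solves_ineq_difference_right_derivative
    [OF assms(1,4,7,6) w_der w_nonneg super]
  have le: "g b \<le> w b" if b: "b \<in> time_interval T" for b
  proof -
    obtain K where K: "K \<ge> 0" "continuous_on {0..b} (\<lambda>t. g t - w t)"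
      "\<And>t. 0 \<le> t \<Longrightarrow> t < b \<Longrightarrow>
        \<exists>D\<le>K * \<bar>g t - w t\<bar>. ((\<lambda>t. g t - w t) has_real_derivative D) (at_right t)"
      using difference[OF _ _ _ b] by blast
    have "g 0 - w 0 \<le> 0" using assms(12) \<mu>_pos[of 0] by (simp add: w_def field_simps)
    then have "g b - w b \<le> 0"
      using right_derivative_le_abs_imp_nonpos[OF K(2) _ _ K(1,3)] b
      by (simp add: time_interval_def)
    then show ?thesis by simp
  qed
  have less: "g b < w b" if "\<mu> 0 * g 0 < 1" and b: "b \<in> time_interval T" for b
  proof -
    obtain K where K: "K \<ge> 0" "continuous_on {0..b} (\<lambda>t. g t - w t)"
      "\<And>t. 0 \<le> t \<Longrightarrow> t < b \<Longrightarrow>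
        \<exists>D\<le>K * \<bar>g t - w t\<bar>. ((\<lambda>t. g t - w t) has_real_derivative D) (at_right t)"
      using difference[OF _ _ _ b] by blast
    have "g 0 - w 0 < 0" using that(1) \<mu>_pos[of 0] by (simp add: w_def field_simps)
    then have "g b - w b < 0"
      using right_derivative_le_abs_imp_neg[OF K(2) _ _ K(3)] b
      by (simp add: time_interval_def)
    then show ?thesis by simp
  qed
  have "T = \<infinity>" if noncont: "noncontinuable \<gamma> \<alpha> \<beta> T g"
  proof (rule ccontr)
    assume "T \<noteq> \<infinity>"
    then obtain r where T: "T = ereal r" and "0 < r" using \<open>0 < T\<close> by (cases T) auto
    \<comment> \<open>As \<open>w\<close> is continuous also at \<open>r\<close>, it is bounded on
      the closed interval \<open>[0, r]\<close>; this gives one bound for \<open>g\<close> on all of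
      \<open>[0, r)\<close>.\<close>
    have "continuous_on {0..} w" using w_der by (intro DERIV_continuous_on) auto
    then have "continuous_on {0..r} w" by (rule continuous_on_subset) auto
    then have "bounded (w ` {0..r})"
      by (intro compact_imp_bounded compact_continuous_image compact_Icc)
    then obtain W where W: "\<And>t. 0 \<le> t \<Longrightarrow> t \<le> r \<Longrightarrow> \<bar>w t\<bar> \<le> W"
      by (force simp: bounded_iff)
    have "0 \<le> g t \<and> g t \<le> W" if "0 \<le> t" "t < r" for t
      using le[of t] W[of t] assms(6) that by (force simp: T time_interval_ereal)
    then show False
      using solves_ineq_continuable[OF assms(1-3) \<open>0 < r\<close> assms(7)[unfolded T]] noncont
      unfolding T by blast
  qed
  then show ?thesis
    using le less assms(6) by (auto simp: w_def)
qed

end
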